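(* $q(\xi)<0$ for $0<\xi<\xi_0$; $q(\xi_0)=0$; and $q(\xi)>0$ for $\xi>\xi_0$.
   Context: $D=\{(t,q)\in\mathbb{R}^2:2t-q>1\}$, $D_0=\{(t,q)\in\mathbb{R}^2:2t-q>1,\ 0\le t\le1\}$. Write $[\omega_1,\dots,\omega_n+x]=\cfrac{1}{\omega_1+\cfrac{1}{\ddots+\cfrac{1}{\omega_n+x}}}$. For $(t,q)\in D$, $$P(t,q)=\lim_{n\to\infty}\frac1n\log\sum_{\omega_1=1}^\infty\cdots\sum_{\omega_n=1}^\infty\exp\Big(\sup_{x\in[0,1]}\log\prod_{j=1}^n\omega_j^q\,([\omega_j,\dots,\omega_n+x])^{2t}\Big),$$ a real-analytic function on $D$. For $\xi>0$, $(t(\xi),q(\xi))\in D_0$ is the unique solution in $D_0$ of the system $P(t,q)=q\xi$, $\frac{\partial P}{\partial q}(t,q)=\xi$. $\xi_0=\int\log a_1(x)\,d\mu_G(x)$, where $a_1(x)=\lfloor1/x\rfloor$ and $d\mu_G=\frac{dx}{(1+x)\log2}$ is the Gauss measure on $[0,1)$. *)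

theory Defs
  imports "HOL-Analysis.Analysis"
begin

text \<open>
  For a word \<open>[\<omega>\<^sub>1, \<dots>, \<omega>\<^sub>n]\<close>, \<open>cf [\<omega>\<^sub>1, \<dots>, \<omega>\<^sub>n] x\<close> is the finite continued fraction
  \<open>[\<omega>\<^sub>1, \<dots>, \<omega>\<^sub>n + x]\<close>. The value at the empty word is chosen so that
  \<open>cf [a] x = 1 / (a + x)\<close>.
\<close>

fun cf :: "nat list \<Rightarrow> real \<Rightarrow> real" where
  "cf [] x = x"
| "cf (a # w) x = 1 / (real a + cf w x)"

definition words :: "nat \<Rightarrow> nat list set" where
  "words n = {w. length w = n \<and> (\<forall>a\<in>set w. 1 \<le> a)}"

text \<open>
  The letter \<open>\<omega>\<^sub>j\<close> (\<open>1 \<le> j \<le> n\<close>) is \<open>w ! (j - 1)\<close>, and the tail \<open>\<omega>\<^sub>j, \<dots>, \<omega>\<^sub>n\<close> is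
  \<open>drop (j - 1) w\<close>; the product below is indexed from 0.
\<close>

definition word_weight :: "real \<Rightarrow> real \<Rightarrow> nat list \<Rightarrow> real" where
  "word_weight t q w =
     exp (SUP x\<in>{0..1}.
       ln (\<Prod>j<length w. real (w ! j) powr q * cf (drop j w) x powr (2 * t)))"

text \<open>
  The iterated sum over \<open>\<omega>\<^sub>1, \<dots>, \<omega>\<^sub>n \<ge> 1\<close> has positive terms and is written as one unordered
  sum over words. The value of \<open>P\<close> is meaningful only where \<open>2 * t - q > 1\<close>; elsewhere these
  sums diverge.
\<close>

definition P :: "real \<Rightarrow> real \<Rightarrow> real" where
  "P t q = lim (\<lambda>n. 1 / real n * ln (\<Sum>\<^sub>\<infinity>w\<in>words n. word_weight t q w))"

definition D0 :: "(real \<times> real) set" where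
  "D0 = {(t, q). 2 * t - q > 1 \<and> 0 \<le> t \<and> t \<le> 1}"

definition solves_system :: "real \<Rightarrow> real \<times> real \<Rightarrow> bool" where
  "solves_system \<xi> = (\<lambda>(t, q).
     P t q = q * \<xi> \<and> ((\<lambda>q'. P t q') has_real_derivative \<xi>) (at q))"

definition unique_solution :: "real \<Rightarrow> real \<times> real \<Rightarrow> bool" where
  "unique_solution \<xi> p \<longleftrightarrow>
     p \<in> D0 \<and> solves_system \<xi> p \<and> (\<forall>p'\<in>D0. solves_system \<xi> p' \<longrightarrow> p' = p)"

definition gauss_measure :: "real measure" where
  "gauss_measure =
     density (restrict_space lborel {0..<1}) (\<lambda>x. ennreal (1 / ((1 + x) * ln 2)))"

definition a1 :: "real \<Rightarrow> int" where
  "a1 x = \<lfloor>1 / x\<rfloor>"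

definition \<xi>\<^sub>0 :: real where
  "\<xi>\<^sub>0 = (LINT x|gauss_measure. ln (real_of_int (a1 x)))"

end

theory Submission
  imports Defs "HOL-Real_Asymp.Real_Asymp"
begin

text \<open>
  On \<open>D0\<close> the supremum in the weight of a word is attained at \<open>x = 0\<close>, so the partition sums are
  submultiplicative and the pressure exists. Three facts suffice:
  \<open>P t q \<ge> P 1 q + (1 - t) * ln 2\<close>, because \<open>[\<omega>\<^sub>j, \<dots>, \<omega>\<^sub>n]\<close> multiplied over \<open>j\<close> decays like
  \<open>2 powr (- n / 2)\<close>; \<open>P 1 q \<ge> q * \<xi>\<^sub>0\<close>, by Jensen's inequality for the invariant Gauss measure; and
  \<open>P 1 0 \<le> 0\<close>, by bounded distortion. A solution \<open>(t, q)\<close> for \<open>\<xi>\<close> thus satisfies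
  \<open>q * \<xi> \<ge> q * \<xi>\<^sub>0 + (1 - t) * ln 2\<close>, which gives the sign of \<open>q\<close> unless \<open>q = 0\<close>; in that case
  \<open>t = 1\<close>, and \<open>P 1\<close> touches the line \<open>q * \<xi>\<^sub>0\<close> from above at 0 with slope \<open>\<xi>\<close>, so \<open>\<xi> = \<xi>\<^sub>0\<close>.
  For \<open>\<xi> = \<xi>\<^sub>0\<close> one gets \<open>t = 1\<close> and \<open>P 1 q = q * \<xi>\<^sub>0\<close>; if \<open>q \<noteq> 0\<close>, convexity makes \<open>P 1\<close> linear
  between 0 and \<open>q\<close>, and \<open>(1, q / 2)\<close> would be a second solution.
\<close>

section \<open>Continued fractions of words, products along a word, and distortion\<close>

text \<open>This is the part of the word weight that carries the exponent \<open>2 * t\<close>. Its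
  square is the modulus of the derivative of \<open>cf w\<close>, as \<open>cf_diff\<close> shows on
  letting the two points merge.\<close>

primrec cf_prod :: "nat list \<Rightarrow> real \<Rightarrow> real" where
  "cf_prod [] x = 1"
| "cf_prod (a # w) x = cf (a # w) x * cf_prod w x"

definition letter_prod :: "nat list \<Rightarrow> real" where
  "letter_prod w = (\<Prod>a\<leftarrow>w. real a)"

lemma letter_prod_simps [simp]:
  "letter_prod [] = 1"
  "letter_prod (a # w) = real a * letter_prod w"
  "letter_prod (u @ v) = letter_prod u * letter_prod v"
  by (simp_all add: letter_prod_def)

lemma words_iff: "w \<in> words n \<longleftrightarrow> length w = n \<and> 0 \<notin> set w"
  by (force simp: words_def Suc_le_eq intro: gr0I)

lemma letter_prod_ge_1: "0 \<notin> set w \<Longrightarrow> 1 \<le> letter_prod w"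
proof (induction w)
  case (Cons a w)
  then have "1 * 1 \<le> real a * letter_prod w"
    by (intro mult_mono) auto
  then show ?case by simp
qed simp

lemma cf_nonneg: "0 \<le> x \<Longrightarrow> 0 \<le> cf w x"
  by (induction w) auto

lemma cf_le_1:
  assumes "0 \<notin> set w" "0 \<le> x" "x \<le> 1"
  shows "cf w x \<le> 1"
proof (cases w)
  case (Cons a v)
  then have "1 \<le> real a + cf v x"
    using assms cf_nonneg[of x v] by auto
  with Cons show ?thesis by simp
qed (use assms in simp)

lemma cf_append: "cf (u @ v) x = cf u (cf v x)"
  by (induction u) auto

lemma cf_prod_append: "cf_prod (u @ v) x = cf_prod u (cf v x) * cf_prod v x"
  by (induction u) (auto simp: cf_append)

lemma cf_prod_pos: "0 \<notin> set w \<Longrightarrow> 0 \<le> x \<Longrightarrow> 0 < cf_prod w x"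
proof (induction w)
  case (Cons a w)
  then have "0 < real a + cf w x"
    using cf_nonneg[of x w] by auto
  with Cons show ?case by simp
qed simp

text \<open>Here \<open>A\<close> and \<open>B\<close> are the denominators of the last two
  convergents, \<open>C\<close> and \<open>D\<close> their numerators. Prepending a letter turns the
  denominator of \<open>cf w x\<close> into the numerator of \<open>cf (a # w) x\<close>, so the
  product telescopes and only the outermost denominator stays. The bound \<open>B \<le> A\<close> is
  what limits distortion.\<close>

lemma cf_mobius:
  assumes "0 \<notin> set w" "w \<noteq> []"
  shows "\<exists>A B C D. 0 < A \<and> 0 \<le> B \<and> B \<le> A \<and> 0 \<le> D \<and> D \<le> C \<and>
           (\<forall>x\<ge>0. cf w x = (C + D * x) / (A + B * x) \<and> cf_prod w x = 1 / (A + B * x))"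
  using assms
proof (induction w)
  case (Cons a w)
  show ?case
  proof (cases "w = []")
    case True
    with Cons.prems show ?thesis
      by (intro exI[of _ "real a"] exI[of _ 1] exI[of _ 1] exI[of _ 0]) auto
  next
    case False
    with Cons obtain A B C D where *: "0 < A" "0 \<le> B" "B \<le> A" "0 \<le> D" "D \<le> C"
      and cf: "\<And>x. 0 \<le> x \<Longrightarrow> cf w x = (C + D * x) / (A + B * x)"
      and pr: "\<And>x. 0 \<le> x \<Longrightarrow> cf_prod w x = 1 / (A + B * x)"
      by auto
    have a: "0 < real a" using Cons.prems by auto
    have aA: "0 < real a * A + C"
      using a * by (simp add: add_pos_nonneg)
    have "cf (a # w) x = (A + B * x) / ((real a * A + C) + (real a * B + D) * x) \<and>
        cf_prod (a # w) x = 1 / ((real a * A + C) + (real a * B + D) * x)" if "0 \<le> x" for x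
    proof -
      have pos: "0 < A + B * x" using * that by (simp add: add_pos_nonneg)
      have pos': "0 < (real a * A + C) + (real a * B + D) * x"
        using aA a * that by (simp add: add_pos_nonneg)
      have "real a + cf w x = ((real a * A + C) + (real a * B + D) * x) / (A + B * x)"
        using pos that by (simp add: cf field_simps)
      then have "cf (a # w) x = (A + B * x) / ((real a * A + C) + (real a * B + D) * x)"
        by simp
      with pos pos' that show ?thesis by (simp add: pr)
    qed
    moreover have "real a * B + D \<le> real a * A + C"
      using a * by (intro add_mono mult_left_mono) auto
    moreover have "0 \<le> real a * B + D"
      using a * by simp
    ultimately have "0 < real a * A + C \<and> 0 \<le> real a * B + D \<and>
        real a * B + D \<le> real a * A + C \<and> 0 \<le> B \<and> B \<le> A \<and>
        (\<forall>x\<ge>0. cf (a # w) x = (A + B * x) / ((real a * A + C) + (real a * B + D) * x) \<and>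
               cf_prod (a # w) x = 1 / ((real a * A + C) + (real a * B + D) * x))"
      using aA *(2,3) by blast
    then show ?thesis by blast
  qed
qed simp

lemma cf_prod_antimono:
  assumes "0 \<notin> set w" "0 \<le> x" "x \<le> y"
  shows "cf_prod w y \<le> cf_prod w x"
proof (cases "w = []")
  case False
  then obtain A B C D where *: "0 < A" "0 \<le> B" "\<And>x. 0 \<le> x \<Longrightarrow> cf_prod w x = 1 / (A + B * x)"
    using cf_mobius[OF assms(1)] by metis
  have "0 < A + B * x" using * assms by (simp add: add_pos_nonneg)
  moreover have "B * x \<le> B * y" using * assms by (intro mult_left_mono) auto
  ultimately show ?thesis using * assms by (auto intro!: divide_left_mono)
qed simp

text \<open>By \<open>cf_mobius\<close> the ratio of the two values is \<open>(A + B) / A\<close>,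
  at most 2 because \<open>B \<le> A\<close>.\<close>

lemma cf_prod_distortion:
  assumes "0 \<notin> set w"
  shows "cf_prod w 0 \<le> 2 * cf_prod w 1"
proof (cases "w = []")
  case False
  then obtain A B C D where *: "0 < A" "0 \<le> B" "B \<le> A" "\<And>x. 0 \<le> x \<Longrightarrow> cf_prod w x = 1 / (A + B * x)"
    using cf_mobius[OF assms(1)] by metis
  then show ?thesis by (auto simp: field_simps)
qed simp

text \<open>An exact mean value identity: each map \<open>1 / (a + z)\<close> reverses the sign of a
  difference and multiplies it by the product of its two values. It yields cylinder lengths, the
  orientation of \<open>cf w\<close> and its continuity at 0.\<close>

lemma cf_diff:
  assumes "0 \<notin> set w" "0 \<le> x" "0 \<le> y"
  shows "cf w x - cf w y = (- 1) ^ length w * (x - y) * (cf_prod w x * cf_prod w y)"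
  using assms
proof (induction w)
  case (Cons a w)
  have p: "0 < real a + cf w x" "0 < real a + cf w y"
    using Cons.prems cf_nonneg[of x w] cf_nonneg[of y w] by auto
  have "cf (a # w) x - cf (a # w) y = - (cf w x - cf w y) * (cf (a # w) x * cf (a # w) y)"
    using p by (simp add: field_simps)
  also have "cf w x - cf w y = (- 1) ^ length w * (x - y) * (cf_prod w x * cf_prod w y)"
    using Cons by simp
  finally show ?case by (simp del: cf.simps)
qed simp

lemma cf_prod_le_letter_prod:
  assumes "0 \<notin> set w" "0 \<le> x"
  shows "cf_prod w x \<le> 1 / letter_prod w"
  using assms(1)
proof (induction w)
  case (Cons a w)
  have "cf (a # w) x \<le> 1 / real a"
    using Cons.prems cf_nonneg[of x w] assms by (auto intro!: divide_left_mono mult_pos_pos add_pos_nonneg)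
  then have "cf (a # w) x * cf_prod w x \<le> 1 / real a * (1 / letter_prod w)"
    using Cons assms cf_prod_pos[of w x] by (intro mult_mono) auto
  then show ?case by simp
qed simp

text \<open>Two consecutive letters contribute a factor of at most 1/2. The extra
  \<open>1 / 2\<close> in the exponent pays for an unpaired letter, whose factor is bounded only by
  1.\<close>

lemma cf_prod_exp_decay:
  assumes "0 \<notin> set w" "0 \<le> x"
  shows "cf_prod w x \<le> 2 powr (1 / 2 - length w / 2)"
  using assms(1)
proof (induction w rule: induct_list012)
  case 1
  show ?case by (simp add: ge_one_powr_ge_zero)
next
  case (2 a)
  then have "1 \<le> real a + x" using assms by auto
  then show ?case by simp
next
  case (3 a b w)
  define z where "z = cf w x"
  have z: "0 \<le> z" using assms cf_nonneg by (simp add: z_def)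
  have ab: "1 \<le> real a" "1 \<le> real b" using 3 by auto
  \<comment> \<open>The two leading fractions multiply to one fraction with denominator
    \<open>a * (b + z) + 1\<close>, which is at least 2.\<close>
  have "1 / (real a + 1 / (real b + z)) * (1 / (real b + z)) = 1 / (real a * (real b + z) + 1)"
    using ab z by (auto simp: field_simps add_pos_nonneg)
  also have "\<dots> \<le> 1 / 2"
    using mult_mono[of 1 "real a" 1 "real b + z"] ab z by (intro divide_left_mono) auto
  finally have "1 / (real a + 1 / (real b + z)) * (1 / (real b + z)) * cf_prod w x \<le> 1 / 2 * cf_prod w x"
    using cf_prod_pos[of w x] 3 assms by (intro mult_right_mono) auto
  then have "cf_prod (a # b # w) x \<le> 1 / 2 * cf_prod w x"
    by (simp add: z_def)
  also have "\<dots> \<le> 2 powr (-1) * 2 powr (1 / 2 - length w / 2)"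
    using 3 by (simp add: powr_minus)
  also have "\<dots> = 2 powr (1 / 2 - length (a # b # w) / 2)"
    unfolding powr_add[symmetric] by (rule arg_cong[where f = "(powr) 2"]) (simp add: field_simps)
  finally show ?case .
qed

text \<open>Since \<open>0 \<le> t\<close>, the product under the supremum does not increase with
  \<open>x\<close>, by \<open>cf_prod_antimono\<close>, so the value at \<open>x = 0\<close> is the
  supremum.\<close>

lemma word_weight_eq:
  assumes "0 \<notin> set w" "0 \<le> t"
  shows "word_weight t q w = letter_prod w powr q * cf_prod w 0 powr (2 * t)"
proof -
  define f where "f x = (\<Prod>j<length w. real (w ! j) powr q * cf (drop j w) x powr (2 * t))" for x
  have f: "f x = letter_prod w powr q * cf_prod w x powr (2 * t)" if "0 \<le> x" for x
    unfolding f_def using assms(1)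
  proof (induction w)
    case (Cons a w)
    have "0 \<le> letter_prod w" "0 \<le> cf_prod w x"
      using letter_prod_ge_1[of w] cf_prod_pos[of w x] Cons.prems that by auto
    moreover have "0 \<le> cf (a # w) x" using that by (rule cf_nonneg)
    ultimately show ?case
      using Cons
      by (simp add: prod.lessThan_Suc_shift powr_mult mult_ac del: prod.lessThan_Suc cf.simps)
  qed simp
  have pos: "0 < f x" if "0 \<le> x" for x
    using letter_prod_ge_1[OF assms(1)] cf_prod_pos[OF assms(1) that] that by (simp add: f)
  have "f x \<le> f 0" if "0 \<le> x" for x
    using that letter_prod_ge_1[OF assms(1)] cf_prod_antimono[OF assms(1), of 0 x] cf_prod_pos[OF assms(1) that] assms
    by (auto simp: f intro!: mult_left_mono powr_mono2)
  then have "(SUP x\<in>{0..1}. ln (f x)) = ln (f 0)"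
    by (intro cSup_eq_maximum) (auto simp: pos)
  then have "word_weight t q w = exp (ln (f 0))"
    by (simp add: word_weight_def f_def)
  with pos[of 0] show ?thesis by (simp add: f)
qed

section \<open>Fekete's lemma for subadditive sequences\<close>

text \<open>The limit is the infimum of \<open>a n / n\<close> over positive \<open>n\<close>; the
  linear lower bound makes it finite.\<close>

lemma fekete_convergent:
  fixes a :: "nat \<Rightarrow> real"
  assumes sub: "\<And>m n. a (m + n) \<le> a m + a n"
    and low: "\<And>n. - c * real n \<le> a n"
  shows "convergent (\<lambda>n. a n / real n)"
proof -
  define L where "L = (INF n\<in>{1..}. a n / real n)"
  have bdd: "bdd_below ((\<lambda>n. a n / real n) ` {1..})"
    using low by (intro bdd_belowI[of _ "- c"]) (auto simp: field_simps)
  have L_le: "L \<le> a n / real n" if "1 \<le> n" for n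
    unfolding L_def using bdd that by (intro cINF_lower) auto
  have mult: "a (k * m + r) \<le> real k * a m + a r" for k m r
  proof (induction k)
    case (Suc k)
    then show ?case
      using sub[of m "k * m + r"] by (simp add: algebra_simps)
  qed simp
  have "(\<lambda>n. a n / real n) \<longlonglongrightarrow> L"
  proof (rule LIMSEQ_I)
    fix e :: real assume e: "0 < e"
    have "\<exists>n\<in>{1..}. a n / real n < L + e / 2"
      using cINF_less_iff[OF _ bdd, of "L + e / 2"] e by (auto simp: L_def)
    then obtain m where m: "1 \<le> m" "a m / real m < L + e / 2" by auto
    \<comment> \<open>Writing \<open>n = k * m + r\<close> with \<open>r < m\<close>, the constant
      \<open>M\<close> absorbs \<open>a r\<close> and the correction \<open>r * (L + e / 2)\<close>,
      uniformly in \<open>n\<close>.\<close>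
    define M where "M = Max ((\<lambda>r. \<bar>a r\<bar>) ` {..<m}) + real m * \<bar>L + e / 2\<bar>"
    have bound: "a n \<le> real n * (L + e / 2) + M" for n
    proof -
      have n: "real n = real (n div m) * real m + real (n mod m)"
        by (metis div_mult_mod_eq of_nat_add of_nat_mult)
      have "a n \<le> real (n div m) * a m + a (n mod m)"
        using mult[of "n div m" m "n mod m"] by simp
      moreover have "a (n mod m) \<le> Max ((\<lambda>r. \<bar>a r\<bar>) ` {..<m})"
        using m by (intro order.trans[OF abs_ge_self Max_ge]) auto
      moreover have "real (n div m) * a m \<le> real (n div m) * (real m * (L + e / 2))"
        using m by (intro mult_left_mono) (auto simp: field_simps)
      moreover have "real (n div m) * (real m * (L + e / 2)) =
          real n * (L + e / 2) - real (n mod m) * (L + e / 2)"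
        by (subst n) (simp add: algebra_simps)
      moreover have "- (real (n mod m) * (L + e / 2)) \<le> real (n mod m) * \<bar>L + e / 2\<bar>"
        by (metis abs_ge_minus_self abs_mult abs_of_nat)
      moreover have "real (n mod m) * \<bar>L + e / 2\<bar> \<le> real m * \<bar>L + e / 2\<bar>"
        using m by (intro mult_right_mono) (auto intro: less_imp_le)
      \<comment> \<open>The estimates above form one linear chain; stating it with variables lets
        their products count as atoms.\<close>
      moreover have "x \<le> p + (b + z)"
        if "x \<le> u + v" "v \<le> b" "u \<le> c" "c = p - r" "- r \<le> s" "s \<le> z" for x u v b c p r s z :: real
        using that by linarith
      ultimately show ?thesis unfolding M_def by blast
    qed
    obtain N :: nat where N: "2 * \<bar>M\<bar> / e < real N" using reals_Archimedean2 by blast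
    show "\<exists>no. \<forall>n\<ge>no. norm (a n / real n - L) < e"
    proof (intro exI[of _ "max 1 N"] allI impI)
      fix n assume n: "max 1 N \<le> n"
      then have "2 * \<bar>M\<bar> / e < real n" "0 < real n" using N by auto
      then have "M < real n * (e / 2)" using e by (auto simp: field_simps)
      with bound[of n] have "a n < real n * (L + e)" by (simp add: algebra_simps)
      then have "a n / real n < L + e" using \<open>0 < real n\<close> by (simp add: field_simps)
      with L_le[of n] n show "norm (a n / real n - L) < e" by auto
    qed
  qed
  then show ?thesis by (rule convergentI)
qed

section \<open>Summation over words\<close>

lemma bij_betw_words_add:
  "bij_betw (\<lambda>(u, v). u @ v) (words m \<times> words n) (words (m + n))"
  unfolding bij_betw_def
proof
  show "inj_on (\<lambda>(u, v). u @ v) (words m \<times> words n)"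
    by (auto simp: inj_on_def words_iff)
  show "(\<lambda>(u, v). u @ v) ` (words m \<times> words n) = words (m + n)"
  proof (intro equalityI subsetI)
    fix w assume "w \<in> words (m + n)"
    then have "w = (\<lambda>(u, v). u @ v) (take m w, drop m w)"
      "(take m w, drop m w) \<in> words m \<times> words n"
      by (auto simp: words_iff dest: in_set_takeD in_set_dropD)
    then show "w \<in> (\<lambda>(u, v). u @ v) ` (words m \<times> words n)" by blast
  qed (auto simp: words_iff)
qed

lemma bij_betw_words_Suc:
  "bij_betw (\<lambda>(a, w). a # w) ({1..} \<times> words n) (words (Suc n))"
  unfolding bij_betw_def
proof
  show "(\<lambda>(a, w). a # w) ` ({1..} \<times> words n) = words (Suc n)"
  proof (intro equalityI subsetI)
    fix w assume "w \<in> words (Suc n)"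
    then show "w \<in> (\<lambda>(a, w). a # w) ` ({1..} \<times> words n)"
      by (cases w) (auto simp: words_iff image_iff)
  qed (auto simp: words_iff)
qed (auto simp: inj_on_def)

lemma words_0: "words 0 = {[]}"
  by (auto simp: words_iff)

lemma has_sum_words_Suc_iff:
  "(f has_sum s) (words (Suc n)) \<longleftrightarrow> ((\<lambda>(a, w). f (a # w)) has_sum s) ({1..} \<times> words n)"
  using has_sum_reindex_bij_betw[OF bij_betw_words_Suc, where f = f and S = s]
  by (simp add: case_prod_unfold)

text \<open>Iterated summation with the rest of the word inside and the first letter outside.
  Nonnegativity makes the family summable over the product set.\<close>

lemma has_sum_words_SucI:
  fixes f :: "nat list \<Rightarrow> real"
  assumes "\<And>a. 1 \<le> a \<Longrightarrow> ((\<lambda>w. f (a # w)) has_sum g a) (words n)"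
    and "(g has_sum s) {1..}"
    and "\<And>w. w \<in> words (Suc n) \<Longrightarrow> 0 \<le> f w"
  shows "(f has_sum s) (words (Suc n))"
proof -
  have nonneg: "0 \<le> f (a # w)" if "1 \<le> a" "w \<in> words n" for a w
    using that by (intro assms(3)) (auto simp: words_iff)
  have "(\<lambda>(a, w). f (a # w)) summable_on ({1..} \<times> words n)"
    by (rule summable_on_SigmaI[where g = g])
       (use assms nonneg in \<open>auto intro: has_sum_imp_summable\<close>)
  then show ?thesis
    unfolding has_sum_words_Suc_iff
    by (intro has_sum_SigmaI[where g = g]) (use assms in auto)
qed

text \<open>The opposite order: for a fixed tail the first letter is summed first. Invariance of the
  Gauss measure comes in this order.\<close>

lemma has_sum_words_SucI':
  fixes f :: "nat list \<Rightarrow> real"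
  assumes "\<And>w. w \<in> words n \<Longrightarrow> ((\<lambda>a. f (a # w)) has_sum g w) {1..}"
    and "(g has_sum s) (words n)"
    and "\<And>w. w \<in> words (Suc n) \<Longrightarrow> 0 \<le> f w"
  shows "(f has_sum s) (words (Suc n))"
proof -
  have nonneg: "0 \<le> f (a # w)" if "1 \<le> a" "w \<in> words n" for a w
    using that by (intro assms(3)) (auto simp: words_iff)
  have sm: "(\<lambda>(w, a). f (a # w)) summable_on (words n \<times> {1..})"
    by (rule summable_on_SigmaI[where g = g])
       (use assms nonneg in \<open>auto intro: has_sum_imp_summable\<close>)
  then have "((\<lambda>(w, a). f (a # w)) has_sum s) (words n \<times> {1..})"
    by (intro has_sum_SigmaI[where g = g]) (use assms in auto)
  also have "?this \<longleftrightarrow> ((\<lambda>(a, w). f (a # w)) has_sum s) ({1..} \<times> words n)"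
    by (rule has_sum_reindex_bij_witness[where i = prod.swap and j = prod.swap]) auto
  finally show ?thesis unfolding has_sum_words_Suc_iff .
qed

lemma has_sum_positive_nat_iff:
  "(f has_sum s) {1..} \<longleftrightarrow> ((\<lambda>n. f (Suc n)) has_sum s) UNIV"
proof -
  have "bij_betw Suc UNIV {1..}"
    by (auto simp: bij_betw_def image_iff Suc_le_eq gr0_conv_Suc)
  from has_sum_reindex_bij_betw[OF this, where f = f and S = s] show ?thesis by simp
qed

lemma summable_letter_powr:
  fixes s :: real
  assumes "s < - 1"
  shows "(\<lambda>a. real a powr s) summable_on {1..}"
proof -
  have "(\<lambda>a. real a powr s) summable_on UNIV"
    using assms by (subst summable_on_UNIV_nonneg_real_iff) (auto simp: summable_real_powr_iff)
  then show ?thesis by (rule summable_on_subset_banach) simp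
qed

text \<open>The sum factorises over the positions of the word, and each factor is a convergent
  series over one letter.\<close>

lemma summable_letter_prod_powr:
  fixes s :: real
  assumes "s < - 1"
  shows "(\<lambda>w. letter_prod w powr s) summable_on words n"
proof (induction n)
  case (Suc n)
  have "((\<lambda>w. letter_prod w powr s) has_sum
      ((\<Sum>\<^sub>\<infinity>a\<in>{1..}. real a powr s) * (\<Sum>\<^sub>\<infinity>w\<in>words n. letter_prod w powr s))) (words (Suc n))"
  proof (rule has_sum_words_SucI)
    show "((\<lambda>a. real a powr s * (\<Sum>\<^sub>\<infinity>w\<in>words n. letter_prod w powr s)) has_sum
        ((\<Sum>\<^sub>\<infinity>a\<in>{1..}. real a powr s) * (\<Sum>\<^sub>\<infinity>w\<in>words n. letter_prod w powr s))) {1..}"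
      by (intro has_sum_cmult_left has_sum_infsum summable_letter_powr assms)
    show "((\<lambda>w. letter_prod (a # w) powr s) has_sum
        (real a powr s * (\<Sum>\<^sub>\<infinity>w\<in>words n. letter_prod w powr s))) (words n)" for a
    proof -
      have "((\<lambda>w. real a powr s * letter_prod w powr s) has_sum
        (real a powr s * (\<Sum>\<^sub>\<infinity>w\<in>words n. letter_prod w powr s))) (words n)"
        by (intro has_sum_cmult_right has_sum_infsum Suc)
      also have "?this \<longleftrightarrow> ?thesis"
        by (intro has_sum_cong) (use letter_prod_ge_1 in \<open>force simp: words_iff powr_mult\<close>)
      finally show ?thesis .
    qed
  qed auto
  then show ?case by (rule has_sum_imp_summable)
qed (simp add: words_0)

section \<open>Partition sums and existence of the pressure\<close>

definition Z :: "real \<Rightarrow> real \<Rightarrow> nat \<Rightarrow> real" where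
  "Z t q n = (\<Sum>\<^sub>\<infinity>w\<in>words n. word_weight t q w)"

lemma word_weight_pos: "0 < word_weight t q w"
  by (simp add: word_weight_def)

lemma word_weight_nonneg: "0 \<le> word_weight t q w"
  using word_weight_pos by (rule less_imp_le)

text \<open>Each suffix fraction is at most the reciprocal of its first letter, so the weight is at
  most a power of \<open>letter_prod w\<close> with exponent \<open>q - 2 * t < - 1\<close>.\<close>

lemma word_weight_summable:
  assumes "2 * t - q > 1" "0 \<le> t"
  shows "word_weight t q summable_on words n"
proof (rule summable_on_comparison_test)
  show "(\<lambda>w. letter_prod w powr (q - 2 * t)) summable_on words n"
    using assms by (intro summable_letter_prod_powr) auto
  fix w assume w: "w \<in> words n"
  then have w0: "0 \<notin> set w" by (simp add: words_iff)
  have "cf_prod w 0 powr (2 * t) \<le> (1 / letter_prod w) powr (2 * t)"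
    using cf_prod_le_letter_prod[OF w0, of 0] cf_prod_pos[OF w0, of 0] assms by (intro powr_mono2) auto
  also have "\<dots> = letter_prod w powr (- 2 * t)"
    using letter_prod_ge_1[OF w0] by (simp add: powr_minus powr_divide inverse_eq_divide)
  finally have "word_weight t q w \<le> letter_prod w powr q * letter_prod w powr (- 2 * t)"
    using assms by (simp add: word_weight_eq[OF w0] mult_left_mono)
  then show "word_weight t q w \<le> letter_prod w powr (q - 2 * t)"
    by (simp flip: powr_add)
  show "0 \<le> word_weight t q w" by (rule word_weight_nonneg)
qed

lemma Z_ge_word_weight:
  assumes "2 * t - q > 1" "0 \<le> t" "w \<in> words n"
  shows "word_weight t q w \<le> Z t q n"
proof -
  have "infsum (word_weight t q) {w} \<le> infsum (word_weight t q) (words n)"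
    using assms word_weight_summable[OF assms(1,2)]
    by (intro infsum_mono2) (auto simp: word_weight_nonneg)
  then show ?thesis by (simp add: Z_def)
qed

lemma replicate_1_in_words: "replicate n 1 \<in> words n"
  by (simp add: words_iff)

lemma Z_pos:
  assumes "2 * t - q > 1" "0 \<le> t"
  shows "0 < Z t q n"
  using word_weight_pos Z_ge_word_weight[OF assms replicate_1_in_words] by (rule less_le_trans)

text \<open>By \<open>cf_prod_append\<close>, appending \<open>v\<close> moves the evaluation point
  for \<open>u\<close> from 0 to \<open>cf v 0\<close>, which can only lower
  \<open>cf_prod u\<close>.\<close>

lemma word_weight_append_le:
  assumes "0 \<notin> set u" "0 \<notin> set v" "0 \<le> t"
  shows "word_weight t q (u @ v) \<le> word_weight t q u * word_weight t q v"
proof -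
  have "cf_prod (u @ v) 0 \<le> cf_prod u 0 * cf_prod v 0"
    using assms cf_prod_antimono[of u 0 "cf v 0"] cf_nonneg[of 0 v] cf_prod_pos[of v 0]
    by (auto simp: cf_prod_append intro!: mult_right_mono)
  then have "cf_prod (u @ v) 0 powr (2 * t) \<le> (cf_prod u 0 * cf_prod v 0) powr (2 * t)"
    using assms cf_prod_pos[of "u @ v" 0] by (intro powr_mono2) auto
  then have "letter_prod (u @ v) powr q * cf_prod (u @ v) 0 powr (2 * t)
      \<le> letter_prod (u @ v) powr q * (cf_prod u 0 * cf_prod v 0) powr (2 * t)"
    by (rule mult_left_mono) simp
  then show ?thesis
    using assms letter_prod_ge_1[of u] letter_prod_ge_1[of v] cf_prod_pos[of u 0] cf_prod_pos[of v 0]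
    by (simp add: word_weight_eq powr_mult mult_ac)
qed

lemma Z_submult:
  assumes "2 * t - q > 1" "0 \<le> t"
  shows "Z t q (m + n) \<le> Z t q m * Z t q n"
proof -
  let ?W = "word_weight t q"
  have sm: "(?W has_sum Z t q k) (words k)" for k
    unfolding Z_def by (rule has_sum_infsum[OF word_weight_summable[OF assms]])
  have 1: "((\<lambda>v. case (u, v) of (u, v) \<Rightarrow> ?W u * ?W v) has_sum (?W u * Z t q n)) (words n)" for u
    using has_sum_cmult_right[OF sm, of "?W u" n] by simp
  have 2: "((\<lambda>u. ?W u * Z t q n) has_sum (Z t q m * Z t q n)) (words m)"
    by (rule has_sum_cmult_left[OF sm])
  have "(\<lambda>(u, v). ?W u * ?W v) summable_on words m \<times> words n"
    by (rule summable_on_SigmaI[OF 1 has_sum_imp_summable[OF 2]]) (auto simp: word_weight_nonneg)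
  then have A: "((\<lambda>(u, v). ?W u * ?W v) has_sum (Z t q m * Z t q n)) (words m \<times> words n)"
    by (rule has_sum_SigmaI[OF 1 2])
  have B: "((\<lambda>(u, v). ?W (u @ v)) has_sum Z t q (m + n)) (words m \<times> words n)"
    using has_sum_reindex_bij_betw[OF bij_betw_words_add, where f = ?W and S = "Z t q (m + n)"] sm[of "m + n"]
    by (simp add: case_prod_unfold)
  show ?thesis
    by (rule has_sum_mono[OF B A]) (use assms in \<open>auto simp: words_iff intro: word_weight_append_le\<close>)
qed

text \<open>\<open>P\<close> is a \<open>lim\<close>, which says nothing unless the sequence
  converges; Fekete's lemma for \<open>ln (Z t q n)\<close> provides this.\<close>

lemma pressure_LIMSEQ:
  assumes "2 * t - q > 1" "0 \<le> t"
  shows "(\<lambda>n. ln (Z t q n) / real n) \<longlonglongrightarrow> P t q"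
proof -
  have "convergent (\<lambda>n. ln (Z t q n) / real n)"
  proof (rule fekete_convergent)
    show "ln (Z t q (m + n)) \<le> ln (Z t q m) + ln (Z t q n)" for m n
      using Z_submult[OF assms, of m n] Z_pos[OF assms] by (simp flip: ln_mult_pos)
    fix n
    \<comment> \<open>The word of ones alone gives the linear lower bound: each of its suffix
      fractions is at least 1/2.\<close>
    define w where "w = replicate n (1::nat)"
    have w: "0 \<notin> set w" "letter_prod w = 1"
      by (induction n) (auto simp: w_def letter_prod_def)
    have "(1 / 2) ^ n \<le> cf_prod w 0"
      unfolding w_def
    proof (induction n)
      case (Suc n)
      have "cf (replicate n 1) 0 \<le> 1" by (rule cf_le_1) auto
      then have "1 / 2 \<le> cf (replicate (Suc n) 1) 0"
        using cf_nonneg[of 0 "replicate n 1"] by (auto intro!: divide_left_mono)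
      then have "1 / 2 * (1 / 2) ^ n \<le> cf (replicate (Suc n) 1) 0 * cf_prod (replicate n 1) 0"
        using Suc cf_nonneg[of 0 "replicate (Suc n) 1"] by (intro mult_mono) auto
      then show ?case by simp
    qed simp
    then have "((1 / 2) ^ n) powr (2 * t) \<le> word_weight t q w"
      using assms w by (simp add: word_weight_eq powr_mono2)
    also have "\<dots> \<le> Z t q n"
      using assms by (simp add: w_def Z_ge_word_weight replicate_1_in_words[simplified])
    finally have "ln (((1 / 2) ^ n) powr (2 * t)) \<le> ln (Z t q n)"
      by (intro ln_mono) auto
    then show "- (2 * t * ln 2) * real n \<le> ln (Z t q n)"
      by (simp add: ln_powr ln_realpow ln_div mult_ac)
  qed
  then have "convergent (\<lambda>n. 1 / real n * ln (\<Sum>\<^sub>\<infinity>w\<in>words n. word_weight t q w))"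
    by (simp add: Z_def)
  then show ?thesis
    unfolding P_def by (simp add: convergent_LIMSEQ_iff Z_def)
qed

section \<open>The Gauss measure of cylinders\<close>

text \<open>
  The Gauss measure of the cylinder set of \<open>w\<close>, the interval with endpoints \<open>cf w 0\<close> and \<open>cf w 1\<close>.
\<close>

definition gauss_cyl :: "nat list \<Rightarrow> real" where
  "gauss_cyl w = \<bar>ln (1 + cf w 0) - ln (1 + cf w 1)\<bar> / ln 2"

lemma gauss_cyl_nonneg: "0 \<le> gauss_cyl w"
  by (simp add: gauss_cyl_def)

text \<open>The derivative of \<open>ln (1 + x)\<close> lies between 1/2 and 1 on the unit interval.
  Both bounds come from \<open>ln z \<le> z - 1\<close>, applied to a quotient and to its
  reciprocal.\<close>

lemma ln_1_add_diff_bounds: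
  fixes x y :: real
  assumes "0 \<le> x" "x \<le> 1" "0 \<le> y" "y \<le> 1"
  shows "\<bar>x - y\<bar> / 2 \<le> \<bar>ln (1 + x) - ln (1 + y)\<bar>" "\<bar>ln (1 + x) - ln (1 + y)\<bar> \<le> \<bar>x - y\<bar>"
proof -
  have *: "(y - x) / 2 \<le> ln (1 + y) - ln (1 + x) \<and> ln (1 + y) - ln (1 + x) \<le> y - x"
    if "0 \<le> x" "x \<le> y" "y \<le> 1" for x y :: real
  proof
    have "ln (1 + y) - ln (1 + x) = ln ((1 + y) / (1 + x))"
      using that by (simp add: ln_div)
    also have "\<dots> \<le> (1 + y) / (1 + x) - 1"
      using that by (intro ln_le_minus_one) auto
    also have "\<dots> = (y - x) / (1 + x)"
      using that by (simp add: field_simps)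
    also have "\<dots> \<le> (y - x) / 1"
      using that by (intro divide_left_mono) auto
    finally show "ln (1 + y) - ln (1 + x) \<le> y - x" by simp
    have "(y - x) / 2 \<le> (y - x) / (1 + y)"
      using that by (intro divide_left_mono) auto
    also have "\<dots> = - ((1 + x) / (1 + y) - 1)"
      using that by (simp add: field_simps)
    also have "\<dots> \<le> - ln ((1 + x) / (1 + y))"
      using that ln_le_minus_one[of "(1 + x) / (1 + y)"] by simp
    also have "\<dots> = ln (1 + y) - ln (1 + x)"
      using that by (simp add: ln_div)
    finally show "(y - x) / 2 \<le> ln (1 + y) - ln (1 + x)" .
  qed
  show "\<bar>x - y\<bar> / 2 \<le> \<bar>ln (1 + x) - ln (1 + y)\<bar>" "\<bar>ln (1 + x) - ln (1 + y)\<bar> \<le> \<bar>x - y\<bar>"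
    using *[of x y] *[of y x] assms by (cases "x \<le> y"; simp)+
qed

text \<open>The Gauss measure is comparable to the weight at \<open>t = 1\<close>,
  \<open>q = 0\<close>. By \<open>cf_diff\<close> the cylinder has length
  \<open>cf_prod w 0 * cf_prod w 1\<close>. In the second bound, distortion and the density each
  cost a factor 2, hence the 4.\<close>

lemma gauss_cyl_bounds:
  assumes "0 \<notin> set w"
  shows "gauss_cyl w \<le> cf_prod w 0 ^ 2 / ln 2" "cf_prod w 0 ^ 2 \<le> 4 * ln 2 * gauss_cyl w"
proof -
  let ?g = "cf_prod w"
  have d: "\<bar>cf w 0 - cf w 1\<bar> = ?g 0 * ?g 1"
    using cf_prod_pos[OF assms, of 0] cf_prod_pos[OF assms, of 1]
    by (simp add: cf_diff[OF assms] abs_mult)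
  have b: "0 \<le> cf w 0" "cf w 0 \<le> 1" "0 \<le> cf w 1" "cf w 1 \<le> 1"
    using cf_nonneg cf_le_1 assms by auto
  have g: "0 < ?g 0" "?g 1 \<le> ?g 0" "?g 0 \<le> 2 * ?g 1"
    using cf_prod_pos[OF assms, of 0] cf_prod_antimono[OF assms, of 0 1] cf_prod_distortion[OF assms] by auto
  have "\<bar>ln (1 + cf w 0) - ln (1 + cf w 1)\<bar> \<le> ?g 0 * ?g 1"
    using ln_1_add_diff_bounds(2)[OF b] d by simp
  also have "\<dots> \<le> ?g 0 ^ 2"
    using g by (simp add: power2_eq_square)
  finally show "gauss_cyl w \<le> ?g 0 ^ 2 / ln 2"
    by (simp add: gauss_cyl_def divide_right_mono)
  have "?g 0 ^ 2 \<le> ?g 0 * (2 * ?g 1)"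
    using g by (simp add: power2_eq_square)
  also have "\<dots> \<le> 4 * \<bar>ln (1 + cf w 0) - ln (1 + cf w 1)\<bar>"
    using ln_1_add_diff_bounds(1)[OF b] d by (simp add: mult_ac)
  finally show "?g 0 ^ 2 \<le> 4 * ln 2 * gauss_cyl w"
    by (simp add: gauss_cyl_def)
qed

text \<open>The increments of a monotone sequence have one sign, so the sum still telescopes after
  taking absolute values.\<close>

lemma monotone_telescope_has_sum:
  fixes h :: "nat \<Rightarrow> real"
  assumes "incseq h \<or> decseq h" "h \<longlonglongrightarrow> l"
  shows "((\<lambda>n. \<bar>h n - h (Suc n)\<bar>) has_sum \<bar>h 0 - l\<bar>) UNIV"
  using assms(1)
proof
  assume h: "incseq h"
  have "(\<lambda>n. h (Suc n) - h n) sums (l - h 0)"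
    by (rule telescope_sums[OF assms(2)])
  moreover have "\<bar>h n - h (Suc n)\<bar> = h (Suc n) - h n" for n using h by (simp add: incseq_SucD)
  moreover have "\<bar>h 0 - l\<bar> = l - h 0" using incseq_le[OF h assms(2), of 0] by simp
  ultimately show ?thesis
    by (intro sums_nonneg_imp_has_sum abs_ge_zero) simp
next
  assume h: "decseq h"
  have "(\<lambda>n. h n - h (Suc n)) sums (h 0 - l)"
    by (rule telescope_sums'[OF assms(2)])
  moreover have "\<bar>h n - h (Suc n)\<bar> = h n - h (Suc n)" for n using h by (simp add: decseq_SucD)
  moreover have "\<bar>h 0 - l\<bar> = h 0 - l" using decseq_ge[OF h assms(2), of 0] by simp
  ultimately show ?thesis
    by (intro sums_nonneg_imp_has_sum abs_ge_zero) simp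
qed

text \<open>Invariance under the Gauss map: the preimage of the cylinder of \<open>w\<close>
  consists of the cylinders of all \<open>a # w\<close>. The sum telescopes because
  \<open>1 + 1 / (a + z) = (a + 1 + z) / (a + z)\<close>.\<close>

lemma gauss_cyl_invariant:
  "((\<lambda>a. gauss_cyl (a # w)) has_sum gauss_cyl w) {1..}"
proof -
  define x where "x = cf w 0"
  define y where "y = cf w 1"
  have xy: "0 \<le> x" "0 \<le> y" by (auto simp: x_def y_def cf_nonneg)
  \<comment> \<open>Up to sign and the factor \<open>1 / ln 2\<close>, \<open>h 0\<close> is
    \<open>gauss_cyl w\<close> and the increment from \<open>h n\<close> to \<open>h (Suc n)\<close>
    is \<open>gauss_cyl (Suc n # w)\<close>.\<close>
  define h where "h n = ln (real (Suc n) + x) - ln (real (Suc n) + y)" for n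
  have "h \<longlonglongrightarrow> 0" unfolding h_def by real_asymp
  moreover have "incseq h \<or> decseq h"
  proof -
    have d: "h (Suc n) - h n = ln (1 + 1 / (real (Suc n) + x)) - ln (1 + 1 / (real (Suc n) + y))" for n
    proof -
      have "1 + 1 / (real (Suc n) + z) = (real (Suc (Suc n)) + z) / (real (Suc n) + z)"
        if "0 \<le> z" for z :: real using that by (simp add: field_simps)
      then show ?thesis using xy by (simp add: h_def ln_div)
    qed
    show ?thesis
    proof (cases "x \<le> y")
      case True
      then have "0 \<le> h (Suc n) - h n" for n
        unfolding d using xy by (auto intro!: ln_mono divide_left_mono add_pos_nonneg)
      then show ?thesis by (auto intro: incseq_SucI)
    next
      case False
      then have "h (Suc n) - h n \<le> 0" for n
        unfolding d using xy by (auto intro!: ln_mono divide_left_mono add_pos_nonneg)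
      then show ?thesis by (auto intro: decseq_SucI)
    qed
  qed
  ultimately have "((\<lambda>n. \<bar>h n - h (Suc n)\<bar> * (1 / ln 2)) has_sum (\<bar>h 0 - 0\<bar> * (1 / ln 2))) UNIV"
    by (intro has_sum_cmult_left monotone_telescope_has_sum)
  moreover have "\<bar>h n - h (Suc n)\<bar> * (1 / ln 2) = gauss_cyl (Suc n # w)" for n
  proof -
    have "1 + 1 / (real (Suc n) + z) = (real (Suc (Suc n)) + z) / (real (Suc n) + z)"
      if "0 \<le> z" for z :: real using that by (simp add: field_simps)
    then have "ln (1 + 1 / (real (Suc n) + z)) = ln (real (Suc (Suc n)) + z) - ln (real (Suc n) + z)"
      if "0 \<le> z" for z :: real using that by (simp add: ln_div)
    then have "ln (1 + cf (Suc n # w) 0) - ln (1 + cf (Suc n # w) 1) = h (Suc n) - h n"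
      using xy by (simp add: h_def x_def y_def)
    then show ?thesis by (simp only: gauss_cyl_def abs_minus_commute times_divide_eq_right mult_1_right)
  qed
  moreover have "\<bar>h 0 - 0\<bar> * (1 / ln 2) = gauss_cyl w"
    by (simp add: h_def gauss_cyl_def x_def y_def)
  ultimately show ?thesis unfolding has_sum_positive_nat_iff by simp
qed

text \<open>Additivity: the cylinder of \<open>w\<close> splits according to the next letter, and
  the dividing points accumulate only at \<open>cf w 0\<close>.\<close>

lemma gauss_cyl_refine:
  assumes "0 \<notin> set w"
  shows "((\<lambda>a. gauss_cyl (w @ [a])) has_sum gauss_cyl w) {1..}"
proof -
  \<comment> \<open>The cylinder of \<open>w @ [Suc n]\<close> has the endpoints
    \<open>cf w (1 / (n + 1))\<close> and \<open>cf w (1 / (n + 2))\<close>, since appending a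
    letter \<open>a\<close> sends 0 to \<open>1 / a\<close> and 1 to
    \<open>1 / (a + 1)\<close>.\<close>
  define h where "h n = ln (1 + cf w (1 / real (Suc n)))" for n
  have mono: "h m \<le> h n \<longleftrightarrow> 0 \<le> (- 1) ^ length w * (1 / real (Suc n) - 1 / real (Suc m))" for m n
  proof -
    have pos: "0 \<le> a * b \<longleftrightarrow> 0 \<le> a" if "0 < b" for a b :: real
      using that by (simp add: zero_le_mult_iff)
    have "h m \<le> h n \<longleftrightarrow> cf w (1 / real (Suc m)) \<le> cf w (1 / real (Suc n))"
      using cf_nonneg[of "1 / real (Suc m)" w] cf_nonneg[of "1 / real (Suc n)" w]
      unfolding h_def by (subst ln_le_cancel_iff) auto
    also have "\<dots> \<longleftrightarrow> 0 \<le> cf w (1 / real (Suc n)) - cf w (1 / real (Suc m))"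
      by simp
    also have "\<dots> \<longleftrightarrow> 0 \<le> (- 1) ^ length w * (1 / real (Suc n) - 1 / real (Suc m))"
      by (subst cf_diff[OF assms]) (auto intro!: pos mult_pos_pos cf_prod_pos[OF assms] simp del: of_nat_Suc)
    finally show ?thesis .
  qed
  \<comment> \<open>By \<open>cf_diff\<close>, \<open>cf w\<close> preserves or reverses order
    according to the parity of the length of \<open>w\<close>.\<close>
  have "incseq h \<or> decseq h"
    by (cases "even (length w)")
       (auto simp: incseq_Suc_iff decseq_Suc_iff mono frac_le)
  moreover have "h \<longlonglongrightarrow> ln (1 + cf w 0)"
  proof -
    have "(\<lambda>n. cf w (1 / real (Suc n)) - cf w 0) \<longlonglongrightarrow> 0"
    proof (rule Lim_null_comparison)
      show "(\<lambda>n. 1 / real (Suc n) * (cf_prod w 0)\<^sup>2) \<longlonglongrightarrow> 0"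
        by (rule tendsto_mult_left_zero[OF LIMSEQ_Suc[OF lim_1_over_n]])
      have "norm (cf w (1 / real (Suc n)) - cf w 0) \<le> 1 / real (Suc n) * (cf_prod w 0)\<^sup>2" for n
      proof -
        have "norm (cf w (1 / real (Suc n)) - cf w 0)
            = 1 / real (Suc n) * (cf_prod w (1 / real (Suc n)) * cf_prod w 0)"
          using cf_prod_pos[OF assms, of "1 / real (Suc n)"] cf_prod_pos[OF assms, of 0]
          by (subst cf_diff[OF assms]) (auto simp: abs_mult)
        also have "\<dots> \<le> 1 / real (Suc n) * (cf_prod w 0 * cf_prod w 0)"
          using cf_prod_pos[OF assms, of 0] cf_prod_antimono[OF assms, of 0 "1 / real (Suc n)"]
          by (intro mult_left_mono mult_right_mono) auto
        finally show ?thesis by (simp add: power2_eq_square)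
      qed
      then show "\<forall>\<^sub>F n in sequentially. norm (cf w (1 / real (Suc n)) - cf w 0) \<le> 1 / real (Suc n) * (cf_prod w 0)\<^sup>2"
        by simp
    qed
    then have "(\<lambda>n. cf w (1 / real (Suc n))) \<longlonglongrightarrow> cf w 0"
      by (simp add: LIM_zero_iff)
    then show ?thesis
      unfolding h_def using cf_nonneg[of 0 w] by (intro tendsto_ln tendsto_add) auto
  qed
  ultimately have "((\<lambda>n. \<bar>h n - h (Suc n)\<bar> * (1 / ln 2)) has_sum
      (\<bar>h 0 - ln (1 + cf w 0)\<bar> * (1 / ln 2))) UNIV"
    by (intro has_sum_cmult_left monotone_telescope_has_sum)
  moreover have "\<bar>h n - h (Suc n)\<bar> * (1 / ln 2) = gauss_cyl (w @ [Suc n])" for n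
    by (simp add: h_def gauss_cyl_def cf_append add_ac)
  moreover have "\<bar>h 0 - ln (1 + cf w 0)\<bar> * (1 / ln 2) = gauss_cyl w"
    by (simp add: h_def gauss_cyl_def abs_minus_commute)
  ultimately show ?thesis unfolding has_sum_positive_nat_iff by simp
qed

text \<open>The prefix \<open>u\<close> grows by one letter in each induction step. The empty prefix
  gives total mass 1, and a single letter gives the marginal of the first digit.\<close>

lemma gauss_cyl_refine_words:
  assumes "0 \<notin> set u"
  shows "((\<lambda>w. gauss_cyl (u @ w)) has_sum gauss_cyl u) (words n)"
  using assms
proof (induction n arbitrary: u)
  case 0
  show ?case by (simp add: words_0 has_sum_finite_iff)
next
  case (Suc n)
  show ?case
  proof (rule has_sum_words_SucI)
    show "((\<lambda>w. gauss_cyl (u @ a # w)) has_sum gauss_cyl (u @ [a])) (words n)" if "1 \<le> a" for a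
      using Suc.IH[of "u @ [a]"] Suc.prems that by simp
  qed (use Suc.prems gauss_cyl_refine gauss_cyl_nonneg in auto)
qed

lemma gauss_cyl_Nil: "gauss_cyl [] = 1"
  by (simp add: gauss_cyl_def)

lemma gauss_cyl_has_sum_1: "(gauss_cyl has_sum 1) (words n)"
  using gauss_cyl_refine_words[of "[]" n] by (simp add: gauss_cyl_Nil)

text \<open>The measure of the cylinder of \<open>a\<close> is of order \<open>a powr (- 2)\<close>,
  and \<open>ln a\<close> is at most twice the square root of \<open>a\<close>; this leaves a
  convergent series of exponent -3/2.\<close>

lemma summable_gauss_cyl_ln:
  "(\<lambda>a. gauss_cyl [a] * ln (real a)) summable_on {1..}"
proof (rule summable_on_comparison_test)
  show "(\<lambda>a. real a powr (- 3 / 2) * (2 / ln 2)) summable_on {1..}"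
    by (intro summable_on_cmult_left summable_letter_powr) simp
  fix a :: nat assume "a \<in> {1..}"
  then have a: "1 \<le> real a" by simp
  have "gauss_cyl [a] \<le> real a powr (- 2) / ln 2"
    using gauss_cyl_bounds(1)[of "[a]"] a
    by (simp add: powr_minus powr_realpow power_divide inverse_eq_divide)
  moreover have "ln (real a) \<le> 2 * real a powr (1 / 2)"
    using a ln_le_minus_one[of "real a powr (1 / 2)"] by (simp add: ln_powr)
  ultimately have "gauss_cyl [a] * ln (real a) \<le> real a powr (- 2) / ln 2 * (2 * real a powr (1 / 2))"
    using a by (intro mult_mono) auto
  also have "\<dots> = real a powr (- 2) * real a powr (1 / 2) * (2 / ln 2)"
    by simp
  also have "real a powr (- 2) * real a powr (1 / 2) = real a powr (- 3 / 2)"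
    by (simp flip: powr_add)
  finally show "gauss_cyl [a] * ln (real a) \<le> real a powr (- 3 / 2) * (2 / ln 2)" .
  show "0 \<le> gauss_cyl [a] * ln (real a)"
    using a gauss_cyl_nonneg by simp
qed

section \<open>The constant \<open>\<xi>\<^sub>0\<close> as a series, and Gauss means of
  logarithms\<close>

lemma floor_inverse_eq_iff:
  fixes x :: real
  assumes "0 < x"
  shows "\<lfloor>1 / x\<rfloor> = int (Suc n) \<longleftrightarrow> x \<in> {1 / real (n + 2)<..1 / real (Suc n)}"
  using assms by (auto simp: floor_eq_iff field_simps)

text \<open>On \<open>I n\<close> the first digit is the constant \<open>n + 1\<close>, so the
  integral splits into Gauss measures of these intervals. Working with nonnegative integrals allows
  the exchange of sum and integral.\<close>

lemma \<xi>\<^sub>0_has_sum: "((\<lambda>a. gauss_cyl [a] * ln (real a)) has_sum \<xi>\<^sub>0) {1..}"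
proof -
  define d :: "real \<Rightarrow> real" where "d x = 1 / ((1 + x) * ln 2)" for x
  define c where "c n = gauss_cyl [Suc n] * ln (real (Suc n))" for n
  define I where "I n = {1 / real (n + 2)<..1 / real (Suc n)}" for n :: nat
  let ?f = "\<lambda>x. ln (real_of_int (a1 x))"
  have [measurable]: "d \<in> borel_measurable borel" "?f \<in> borel_measurable borel"
    unfolding d_def a1_def by measurable
  have c_nonneg: "0 \<le> c n" for n
    by (simp add: c_def gauss_cyl_nonneg)
  obtain s where s: "((\<lambda>a. gauss_cyl [a] * ln (real a)) has_sum s) {1..}"
    using summable_gauss_cyl_ln by (auto simp: summable_on_def)
  then have c_sums: "c sums s"
    unfolding has_sum_positive_nat_iff c_def by (rule has_sum_imp_sums)
  have f_nonneg: "0 \<le> ?f x" if "0 \<le> x" "x \<le> 1" for x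
  proof (cases "x = 0")
    case False
    with that have "1 \<le> \<lfloor>1 / x\<rfloor>" by simp
    then show ?thesis by (simp add: a1_def)
  qed (simp add: a1_def)
  have pointwise: "ennreal (d x) * ennreal (?f x) * indicator {0..<1} x =
      (\<Sum>n. ennreal (ln (real (Suc n)) * d x) * indicator (I n) x)" for x
  proof (cases "0 < x \<and> x < 1")
    case True
    then have "1 \<le> \<lfloor>1 / x\<rfloor>" by simp
    then have "\<lfloor>1 / x\<rfloor> = int (Suc (nat (\<lfloor>1 / x\<rfloor> - 1)))" by simp
    then obtain k where k: "\<lfloor>1 / x\<rfloor> = int (Suc k)" ..
    have I: "x \<in> I n \<longleftrightarrow> n = k" for n
      using floor_inverse_eq_iff[of x n] True k by (auto simp: I_def)
    have "(\<Sum>n. ennreal (ln (real (Suc n)) * d x) * indicator (I n) x) =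
        (\<Sum>n\<in>{k}. ennreal (ln (real (Suc n)) * d x) * indicator (I n) x)"
      by (rule suminf_finite) (auto simp: I)
    also have "\<dots> = ennreal (d x) * ennreal (?f x) * indicator {0..<1} x"
    proof -
      have "ennreal (ln (real (Suc k)) * d x) = ennreal (ln (real (Suc k))) * ennreal (d x)"
        using True by (intro ennreal_mult) (auto simp: d_def)
      then show ?thesis using True k by (simp add: I a1_def mult_ac)
    qed
    finally show ?thesis ..
  next
    case False
    \<comment> \<open>The only point outside the open unit interval that some \<open>I n\<close>
      contains is 1; it lies in \<open>I 0\<close>, where the coefficient is
      \<open>ln 1 = 0\<close>.\<close>
    have "ennreal (ln (real (Suc n)) * d x) * indicator (I n) x = 0" for n
    proof (cases "x \<in> I n")
      case True
      moreover have "0 < 1 / real (n + 2)" by simp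
      ultimately have "0 < x" unfolding I_def greaterThanAtMost_iff by linarith
      with False have "1 \<le> x" by simp
      moreover have "x \<le> 1 / real (Suc n)" using True by (simp add: I_def)
      ultimately have "1 \<le> 1 / real (Suc n)" by linarith
      then have "n = 0" by simp
      then show ?thesis by simp
    qed simp
    then have "(\<Sum>n. ennreal (ln (real (Suc n)) * d x) * indicator (I n) x) = 0"
      by (simp only: suminf_zero)
    \<comment> \<open>At 0 the conventions \<open>1 / 0 = 0\<close> and \<open>ln 0 = 0\<close> make
      the integrand vanish.\<close>
    moreover have "?f x = 0 \<or> x \<notin> {0..<1}"
      using False by (cases "x = 0") (auto simp: a1_def)
    ultimately show ?thesis by auto
  qed
  have piece: "(\<integral>\<^sup>+x. ennreal (ln (real (Suc n)) * d x) * indicator (I n) x \<partial>lborel) = ennreal (c n)" for n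
  proof -
    define l r where "l = 1 / real (n + 2)" and "r = 1 / real (Suc n)"
    have lr: "0 < l" "l \<le> r" by (auto simp: l_def r_def frac_le)
    \<comment> \<open>Adding the left endpoint changes a null set only and gives the closed interval
      for the fundamental theorem of calculus.\<close>
    have "(\<integral>\<^sup>+x. ennreal (ln (real (Suc n)) * d x) * indicator (I n) x \<partial>lborel) =
        (\<integral>\<^sup>+x. ennreal (ln (real (Suc n)) * d x) * indicator {l..r} x \<partial>lborel)"
      by (intro nn_integral_cong_AE eventually_mono[OF AE_lborel_singleton[of l]])
         (auto simp: I_def l_def r_def indicator_def)
    also have "\<dots> = ln (real (Suc n)) * (ln (1 + r) / ln 2) - ln (real (Suc n)) * (ln (1 + l) / ln 2)"
    proof (rule nn_integral_FTC_Icc)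
      show "((\<lambda>x. ln (real (Suc n)) * (ln (1 + x) / ln 2)) has_real_derivative ln (real (Suc n)) * d x)
          (at x)" if "x \<in> {l..r}" for x
      proof -
        have "((\<lambda>x. ln (1 + x)) has_real_derivative 1 / (1 + x)) (at x)"
          using lr that by (auto intro!: derivative_eq_intros)
        from DERIV_cmult[OF DERIV_cdivide[OF this]] show ?thesis
          by (simp add: d_def)
      qed
      show "0 \<le> ln (real (Suc n)) * d x" if "x \<in> {l..r}" for x
        using lr that by (auto simp: d_def)
    qed (use lr in auto)
    also have "ln (real (Suc n)) * (ln (1 + r) / ln 2) - ln (real (Suc n)) * (ln (1 + l) / ln 2) = c n"
    proof -
      have "ln (1 + l) \<le> ln (1 + r)" using lr by simp
      then have "gauss_cyl [Suc n] = (ln (1 + r) - ln (1 + l)) / ln 2"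
        by (simp add: gauss_cyl_def l_def r_def add_ac)
      then show ?thesis by (simp only: c_def) (simp add: field_simps)
    qed
    finally show ?thesis .
  qed
  have "\<xi>\<^sub>0 = enn2real (\<integral>\<^sup>+x. ennreal (?f x) \<partial>gauss_measure)"
    unfolding \<xi>\<^sub>0_def
  proof (rule integral_eq_nn_integral)
    show "?f \<in> borel_measurable gauss_measure"
      unfolding gauss_measure_def by (simp add: measurable_restrict_space1)
    show "AE x in gauss_measure. 0 \<le> ?f x"
      by (rule AE_I2) (auto simp: gauss_measure_def space_restrict_space intro!: f_nonneg)
  qed
  also have "(\<integral>\<^sup>+x. ennreal (?f x) \<partial>gauss_measure) =
      (\<integral>\<^sup>+x. ennreal (d x) * ennreal (?f x) \<partial>restrict_space lborel {0..<1})"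
    unfolding gauss_measure_def d_def[symmetric]
    by (intro nn_integral_density measurable_restrict_space1) auto
  also have "\<dots> = (\<integral>\<^sup>+x. ennreal (d x) * ennreal (?f x) * indicator {0..<1} x \<partial>lborel)"
    by (rule nn_integral_restrict_space) simp
  also have "\<dots> = (\<integral>\<^sup>+x. (\<Sum>n. ennreal (ln (real (Suc n)) * d x) * indicator (I n) x) \<partial>lborel)"
    by (simp only: pointwise)
  also have "\<dots> = (\<Sum>n. \<integral>\<^sup>+x. ennreal (ln (real (Suc n)) * d x) * indicator (I n) x \<partial>lborel)"
    unfolding I_def by (rule nn_integral_suminf) measurable
  also have "\<dots> = (\<Sum>n. ennreal (c n))"
    by (simp only: piece)
  also have "\<dots> = ennreal s"
    using c_sums c_nonneg by (simp add: suminf_ennreal2 sums_iff)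
  also have "enn2real (ennreal s) = s"
    using s by (intro enn2real_ennreal has_sum_nonneg[OF s]) (auto simp: gauss_cyl_nonneg)
  finally show ?thesis using s by simp
qed

text \<open>The main hypothesis speaks of positive parameters, so this is what makes it available at
  \<open>\<xi>\<^sub>0\<close>. The term of the letter 2 is already positive.\<close>

lemma \<xi>\<^sub>0_pos: "0 < \<xi>\<^sub>0"
proof -
  have "ln (3 / 2 :: real) \<noteq> ln (4 / 3)" by simp
  then have "0 < gauss_cyl [2] * ln (real 2)"
    by (simp add: gauss_cyl_def)
  also have "\<dots> \<le> \<xi>\<^sub>0"
  proof (rule has_sum_mono2[OF _ \<xi>\<^sub>0_has_sum])
    show "((\<lambda>a. gauss_cyl [a] * ln (real a)) has_sum (gauss_cyl [2] * ln (real 2))) {2}"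
      using has_sum_finite[of "{2}" "\<lambda>a. gauss_cyl [a] * ln (real a)"] by simp
  qed (auto simp: gauss_cyl_nonneg)
  finally show ?thesis .
qed

text \<open>The mean of a Birkhoff sum: the logarithm of the first letter is averaged by refinement
  of cylinders, that of the remaining letters by invariance and induction.\<close>

lemma gauss_cyl_ln_letter_prod_has_sum:
  "((\<lambda>w. gauss_cyl w * ln (letter_prod w)) has_sum (real n * \<xi>\<^sub>0)) (words n)"
proof (induction n)
  case 0
  show ?case by (simp add: words_0 has_sum_finite_iff)
next
  case (Suc n)
  have "((\<lambda>w. gauss_cyl w * ln (real (hd w))) has_sum \<xi>\<^sub>0) (words (Suc n))"
  proof (rule has_sum_words_SucI[OF _ \<xi>\<^sub>0_has_sum])
    show "((\<lambda>w. gauss_cyl (a # w) * ln (real (hd (a # w)))) has_sum (gauss_cyl [a] * ln (real a))) (words n)"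
      if "1 \<le> a" for a
      using has_sum_cmult_left[OF gauss_cyl_refine_words[of "[a]" n]] that by simp
    show "0 \<le> gauss_cyl w * ln (real (hd w))" for w
      using gauss_cyl_nonneg by (cases "hd w = 0") auto
  qed
  moreover have "((\<lambda>w. gauss_cyl w * ln (letter_prod (tl w))) has_sum (real n * \<xi>\<^sub>0)) (words (Suc n))"
  proof (rule has_sum_words_SucI'[OF _ Suc])
    show "((\<lambda>a. gauss_cyl (a # w) * ln (letter_prod (tl (a # w)))) has_sum
        (gauss_cyl w * ln (letter_prod w))) {1..}" for w
      using has_sum_cmult_left[OF gauss_cyl_invariant[of w]] by simp
    show "0 \<le> gauss_cyl w * ln (letter_prod (tl w))" if "w \<in> words (Suc n)" for w
      using that letter_prod_ge_1[of "tl w"] gauss_cyl_nonneg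
      by (cases w) (auto simp: words_iff)
  qed
  ultimately have "((\<lambda>w. gauss_cyl w * ln (real (hd w)) + gauss_cyl w * ln (letter_prod (tl w)))
      has_sum (\<xi>\<^sub>0 + real n * \<xi>\<^sub>0)) (words (Suc n))"
    by (rule has_sum_add)
  also have "?this \<longleftrightarrow> ?case"
  proof -
    have eq: "gauss_cyl w * ln (real (hd w)) + gauss_cyl w * ln (letter_prod (tl w)) =
        gauss_cyl w * ln (letter_prod w)" if "w \<in> words (Suc n)" for w
      using that letter_prod_ge_1[of "tl w"]
      by (cases w) (auto simp: words_iff ln_mult_pos algebra_simps)
    have "\<xi>\<^sub>0 + real n * \<xi>\<^sub>0 = real (Suc n) * \<xi>\<^sub>0"
      by (simp add: algebra_simps)
    then show ?thesis by (simp only: has_sum_cong[OF eq])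
  qed
  finally show ?case .
qed

section \<open>Bounds and convexity of the pressure\<close>

text \<open>Jensen's inequality in tangent form: averaging
  \<open>exp m * (1 + (y - m)) \<le> exp y\<close> over the cylinders, where \<open>m\<close> is the
  mean of \<open>y\<close>, leaves \<open>exp m\<close> on the left.\<close>

lemma pressure_lower_bound:
  assumes "q < 1"
  shows "q * \<xi>\<^sub>0 \<le> P 1 q"
proof -
  have D: "2 * 1 - q > 1" "0 \<le> (1::real)" using assms by auto
  have Z_lower: "ln 2 * exp (q * (real n * \<xi>\<^sub>0)) \<le> Z 1 q n" for n
  proof -
    \<comment> \<open>The mean of \<open>q * ln (letter_prod w)\<close> under the Gauss
      measure.\<close>
    define m where "m = q * (real n * \<xi>\<^sub>0)"
    have "((\<lambda>w. gauss_cyl w * (1 - m) + q * (gauss_cyl w * ln (letter_prod w))) has_sum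
        (1 * (1 - m) + q * (real n * \<xi>\<^sub>0))) (words n)"
      by (intro has_sum_add has_sum_cmult_left has_sum_cmult_right
          gauss_cyl_has_sum_1 gauss_cyl_ln_letter_prod_has_sum)
    then have "((\<lambda>w. ln 2 * exp m *
        (gauss_cyl w * (1 - m) + q * (gauss_cyl w * ln (letter_prod w)))) has_sum
        (ln 2 * exp m * (1 * (1 - m) + q * (real n * \<xi>\<^sub>0)))) (words n)"
      by (rule has_sum_cmult_right)
    moreover have "(word_weight 1 q has_sum Z 1 q n) (words n)"
      unfolding Z_def by (rule has_sum_infsum[OF word_weight_summable[OF D]])
    moreover have "ln 2 * exp m * (gauss_cyl w * (1 - m) + q * (gauss_cyl w * ln (letter_prod w)))
        \<le> word_weight 1 q w" if "w \<in> words n" for w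
    proof -
      have w: "0 \<notin> set w" using that by (simp add: words_iff)
      define y where "y = q * ln (letter_prod w)"
      have "exp m * (1 + (y - m)) \<le> exp m * exp (y - m)"
        by (intro mult_left_mono exp_ge_add_one_self) auto
      also have "\<dots> = letter_prod w powr q"
        using letter_prod_ge_1[OF w] by (simp flip: exp_add add: powr_def y_def)
      finally have "ln 2 * gauss_cyl w * (exp m * (1 + (y - m))) \<le> ln 2 * gauss_cyl w * letter_prod w powr q"
        using gauss_cyl_nonneg by (intro mult_left_mono) auto
      also have "\<dots> \<le> cf_prod w 0 ^ 2 * letter_prod w powr q"
        using gauss_cyl_bounds(1)[OF w] by (intro mult_right_mono) (auto simp: field_simps)
      also have "\<dots> = word_weight 1 q w"
        using cf_prod_pos[OF w, of 0] by (simp add: word_weight_eq[OF w] powr_realpow)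
      finally show ?thesis by (simp add: y_def algebra_simps)
    qed
    ultimately have "ln 2 * exp m * (1 * (1 - m) + q * (real n * \<xi>\<^sub>0)) \<le> Z 1 q n"
      by (rule has_sum_mono)
    then show ?thesis by (simp add: m_def)
  qed
  \<comment> \<open>The factor \<open>ln 2\<close> from comparing weights with
    \<open>gauss_cyl\<close> is lost on division by \<open>n\<close>.\<close>
  have "(\<lambda>n. ln (ln 2) / real n + q * \<xi>\<^sub>0) \<longlonglongrightarrow> 0 + q * \<xi>\<^sub>0"
    by (intro tendsto_add tendsto_const lim_const_over_n)
  moreover have "ln (ln 2) / real n + q * \<xi>\<^sub>0 \<le> ln (Z 1 q n) / real n" if "1 \<le> n" for n
  proof -
    have "ln (ln 2 * exp (q * (real n * \<xi>\<^sub>0))) \<le> ln (Z 1 q n)"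
      by (intro ln_mono Z_lower) simp
    then have "ln (ln 2) + q * (real n * \<xi>\<^sub>0) \<le> ln (Z 1 q n)"
      by (simp add: ln_mult_pos)
    then have "(ln (ln 2) + q * (real n * \<xi>\<^sub>0)) / real n \<le> ln (Z 1 q n) / real n"
      by (rule divide_right_mono) simp
    with that show ?thesis by (simp add: add_divide_distrib)
  qed
  ultimately have "0 + q * \<xi>\<^sub>0 \<le> P 1 q"
    using LIMSEQ_le[OF _ pressure_LIMSEQ[OF D]] by blast
  then show ?thesis by simp
qed

text \<open>The weights are at most \<open>4 * ln 2\<close> times Gauss measures of cylinders, which
  add up to 1, so the partition sums stay bounded.\<close>

lemma pressure_1_0_le: "P 1 0 \<le> 0"
proof -
  have D: "2 * 1 - (0::real) > 1" "0 \<le> (1::real)" by auto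
  have "Z 1 0 n \<le> 4 * ln 2" for n
  proof -
    have "(word_weight 1 0 has_sum Z 1 0 n) (words n)"
      unfolding Z_def by (rule has_sum_infsum[OF word_weight_summable[OF D]])
    moreover have "((\<lambda>w. 4 * ln 2 * gauss_cyl w) has_sum (4 * ln 2 * 1)) (words n)"
      by (intro has_sum_cmult_right gauss_cyl_has_sum_1)
    ultimately have "Z 1 0 n \<le> 4 * ln 2 * 1"
    proof (rule has_sum_mono)
      fix w assume "w \<in> words n"
      then have w: "0 \<notin> set w" by (simp add: words_iff)
      then show "word_weight 1 0 w \<le> 4 * ln 2 * gauss_cyl w"
        using gauss_cyl_bounds(2)[OF w] cf_prod_pos[OF w, of 0] letter_prod_ge_1[OF w]
        by (simp add: word_weight_eq powr_realpow)
    qed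
    then show ?thesis by simp
  qed
  then have "ln (Z 1 0 n) / real n \<le> ln (4 * ln 2) / real n" for n
    using Z_pos[OF D] by (intro divide_right_mono ln_mono) auto
  with LIMSEQ_le[OF pressure_LIMSEQ[OF D] lim_const_over_n] show ?thesis by blast
qed

text \<open>Passing from exponent 1 to \<open>t\<close> divides each weight by
  \<open>cf_prod w 0 powr (2 * (1 - t))\<close>. By \<open>cf_prod_exp_decay\<close> this is a gain
  of at least \<open>2 powr ((n - 1) * (1 - t))\<close>, whose growth rate is
  \<open>(1 - t) * ln 2\<close>.\<close>

lemma pressure_strict_antimono:
  assumes "2 * t - q > 1" "0 \<le> t" "t \<le> 1"
  shows "P 1 q + (1 - t) * ln 2 \<le> P t q"
proof -
  have D: "2 * 1 - q > 1" "0 \<le> (1::real)" using assms by auto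
  have Z_le: "2 powr ((real n - 1) * (1 - t)) * Z 1 q n \<le> Z t q n" for n
  proof -
    have "(word_weight 1 q has_sum Z 1 q n) (words n)"
      unfolding Z_def by (rule has_sum_infsum[OF word_weight_summable[OF D]])
    then have "((\<lambda>w. 2 powr ((real n - 1) * (1 - t)) * word_weight 1 q w) has_sum
        (2 powr ((real n - 1) * (1 - t)) * Z 1 q n)) (words n)"
      by (rule has_sum_cmult_right)
    moreover have "(word_weight t q has_sum Z t q n) (words n)"
      unfolding Z_def by (rule has_sum_infsum[OF word_weight_summable[OF assms(1,2)]])
    ultimately show ?thesis
    proof (rule has_sum_mono)
      fix w assume w': "w \<in> words n"
      then have w: "0 \<notin> set w" "length w = n" by (auto simp: words_iff)
      let ?g = "cf_prod w 0"
      have g: "0 < ?g" using cf_prod_pos[OF w(1)] by simp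
      have "?g powr (2 * (1 - t)) \<le> (2 powr (1 / 2 - length w / 2)) powr (2 * (1 - t))"
        using cf_prod_exp_decay[OF w(1), of 0] g assms by (intro powr_mono2) auto
      also have "\<dots> = 2 powr (- ((real n - 1) * (1 - t)))"
        unfolding powr_powr by (rule arg_cong[where f = "(powr) 2"]) (simp add: w field_simps)
      finally have "2 powr ((real n - 1) * (1 - t)) * ?g powr (2 * (1 - t)) \<le>
          2 powr ((real n - 1) * (1 - t)) * 2 powr (- ((real n - 1) * (1 - t)))"
        by (rule mult_left_mono) simp
      also have "\<dots> = 1" by (simp flip: powr_add)
      finally have "2 powr ((real n - 1) * (1 - t)) * ?g powr (2 * (1 - t)) * (letter_prod w powr q * ?g powr (2 * t))
          \<le> 1 * (letter_prod w powr q * ?g powr (2 * t))"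
        by (rule mult_right_mono) simp
      moreover have "?g powr (2 * 1) = ?g powr (2 * (1 - t)) * ?g powr (2 * t)"
        by (simp flip: powr_add)
      ultimately show "2 powr ((real n - 1) * (1 - t)) * word_weight 1 q w \<le> word_weight t q w"
        using assms w by (simp add: word_weight_eq mult_ac)
    qed
  qed
  have "(\<lambda>n. (1 - 1 / real n) * ((1 - t) * ln 2) + ln (Z 1 q n) / real n)
      \<longlonglongrightarrow> (1 - 0) * ((1 - t) * ln 2) + P 1 q"
    by (intro tendsto_intros pressure_LIMSEQ[OF D] lim_1_over_n)
  moreover have "(1 - 1 / real n) * ((1 - t) * ln 2) + ln (Z 1 q n) / real n \<le> ln (Z t q n) / real n"
    if "1 \<le> n" for n
  proof -
    have "ln (2 powr ((real n - 1) * (1 - t)) * Z 1 q n) \<le> ln (Z t q n)"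
      using Z_pos[OF D, of n] by (intro ln_mono Z_le) auto
    then have "(real n - 1) * (1 - t) * ln 2 + ln (Z 1 q n) \<le> ln (Z t q n)"
      using Z_pos[OF D, of n] by (simp add: ln_mult_pos ln_powr)
    then have "((real n - 1) * (1 - t) * ln 2 + ln (Z 1 q n)) / real n \<le> ln (Z t q n) / real n"
      by (rule divide_right_mono) simp
    moreover have "((real n - 1) * (1 - t) * ln 2 + ln (Z 1 q n)) / real n =
        (1 - 1 / real n) * ((1 - t) * ln 2) + ln (Z 1 q n) / real n"
      using that by (simp add: field_simps)
    ultimately show ?thesis by simp
  qed
  ultimately have "(1 - 0) * ((1 - t) * ln 2) + P 1 q \<le> P t q"
    using LIMSEQ_le[OF _ pressure_LIMSEQ[OF assms(1,2)]] by blast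
  then show ?thesis by simp
qed

text \<open>Hoelder's inequality for the partition sums: the logarithm of a weight is affine in
  \<open>q\<close>, so weights interpolate geometrically.\<close>

lemma pressure_convex:
  assumes "2 * t - q1 > 1" "2 * t - q2 > 1" "0 \<le> t" "0 \<le> s" "s \<le> 1"
  shows "P t ((1 - s) * q1 + s * q2) \<le> (1 - s) * P t q1 + s * P t q2"
proof -
  define q where "q = (1 - s) * q1 + s * q2"
  have "(1 - s) * q1 + s * q2 < 2 * t - 1"
    using assms by (intro convex_bound_lt) auto
  then have D: "2 * t - q > 1" by (simp add: q_def)
  have hZ: "(word_weight t q' has_sum Z t q' n) (words n)" if "2 * t - q' > 1" for q' n
    unfolding Z_def by (rule has_sum_infsum[OF word_weight_summable[OF that assms(3)]])
  have Z_le: "Z t q n \<le> Z t q1 n powr (1 - s) * Z t q2 n powr s" for n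
  proof -
    define A B where "A = Z t q1 n" and "B = Z t q2 n"
    have pos: "0 < A" "0 < B" using Z_pos assms by (auto simp: A_def B_def)
    \<comment> \<open>Hoelder's inequality is obtained termwise from Young's, applied to the weights
      divided by their totals \<open>A\<close> and \<open>B\<close>. The bracket then sums to
      \<open>(1 - s) + s = 1\<close>.\<close>
    have "((\<lambda>w. A powr (1 - s) * B powr s *
          ((1 - s) / A * word_weight t q1 w + s / B * word_weight t q2 w)) has_sum
        (A powr (1 - s) * B powr s * ((1 - s) / A * A + s / B * B))) (words n)"
      unfolding A_def B_def by (intro has_sum_cmult_right has_sum_add hZ assms)
    then have "Z t q n \<le> A powr (1 - s) * B powr s * ((1 - s) / A * A + s / B * B)"
    proof (rule has_sum_mono[OF hZ[OF D]])
      fix w assume "w \<in> words n"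
      then have w: "0 \<notin> set w" by (simp add: words_iff)
      let ?u = "word_weight t q1 w" and ?v = "word_weight t q2 w"
      have uv: "0 < ?u" "0 < ?v" by (rule word_weight_pos)+
      have "word_weight t q w = ?u powr (1 - s) * ?v powr s"
      proof -
        have l: "0 < letter_prod w" "0 < cf_prod w 0"
          using letter_prod_ge_1[OF w] cf_prod_pos[OF w] by auto
        have "ln (word_weight t q w) = (1 - s) * ln ?u + s * ln ?v"
          using l assms by (simp add: word_weight_eq[OF w] ln_mult_pos ln_powr q_def algebra_simps)
        also have "\<dots> = ln (?u powr (1 - s) * ?v powr s)"
          using uv by (simp add: ln_mult_pos ln_powr)
        finally show ?thesis using uv by (simp add: word_weight_pos)
      qed
      also have "\<dots> = A powr (1 - s) * B powr s * ((?u / A) powr (1 - s) * (?v / B) powr s)"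
        using pos uv by (simp add: powr_divide)
      also have "\<dots> \<le> A powr (1 - s) * B powr s * ((1 - s) * (?u / A) + s * (?v / B))"
        using pos uv assms by (intro mult_left_mono Youngs_inequality_0) auto
      finally show "word_weight t q w \<le> A powr (1 - s) * B powr s * ((1 - s) / A * ?u + s / B * ?v)"
        by simp
    qed
    also have "\<dots> = A powr (1 - s) * B powr s" using pos by simp
    finally show ?thesis by (simp add: A_def B_def)
  qed
  have "(\<lambda>n. (1 - s) * (ln (Z t q1 n) / real n) + s * (ln (Z t q2 n) / real n))
      \<longlonglongrightarrow> (1 - s) * P t q1 + s * P t q2"
    by (intro tendsto_intros pressure_LIMSEQ assms)
  moreover have "ln (Z t q n) / real n \<le> (1 - s) * (ln (Z t q1 n) / real n) + s * (ln (Z t q2 n) / real n)" for n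
  proof -
    have pos: "0 < Z t q1 n" "0 < Z t q2 n" using Z_pos assms by auto
    have "ln (Z t q n) \<le> ln (Z t q1 n powr (1 - s) * Z t q2 n powr s)"
      using Z_pos[OF D assms(3)] by (intro ln_mono Z_le)
    also have "\<dots> = (1 - s) * ln (Z t q1 n) + s * ln (Z t q2 n)"
      using pos by (simp add: ln_mult_pos ln_powr)
    finally have "ln (Z t q n) / real n \<le> ((1 - s) * ln (Z t q1 n) + s * ln (Z t q2 n)) / real n"
      by (rule divide_right_mono) simp
    then show ?thesis by (simp add: add_divide_distrib)
  qed
  ultimately show ?thesis
    using LIMSEQ_le[OF pressure_LIMSEQ[OF D assms(3)]] unfolding q_def by blast
qed

section \<open>Solutions of the system\<close>

lemma solution_constraint:
  assumes "(t, q) \<in> D0" "solves_system \<xi> (t, q)"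
  shows "q < 1" "q * \<xi>\<^sub>0 + (1 - t) * ln 2 \<le> q * \<xi>" "t \<le> 1"
proof -
  have D: "2 * t - q > 1" "0 \<le> t" "t \<le> 1" using assms by (auto simp: D0_def)
  then show "q < 1" "t \<le> 1" by auto
  then show "q * \<xi>\<^sub>0 + (1 - t) * ln 2 \<le> q * \<xi>"
    using pressure_lower_bound[of q] pressure_strict_antimono[OF D] assms by (auto simp: solves_system_def)
qed

lemma solution_zero_imp_\<xi>\<^sub>0:
  assumes "(t, 0) \<in> D0" "solves_system \<xi> (t, 0)"
  shows "\<xi> = \<xi>\<^sub>0"
proof -
  have "(1 - t) * ln 2 \<le> 0" "t \<le> 1" using solution_constraint[OF assms] by auto
  then have t: "t = 1" by (auto simp: mult_le_0_iff)
  have P0: "P 1 0 = 0" and der: "((\<lambda>q. P 1 q) has_real_derivative \<xi>) (at 0)"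
    using assms by (auto simp: solves_system_def t)
  have "((\<lambda>q. P 1 q - q * \<xi>\<^sub>0) has_real_derivative \<xi> - 1 * \<xi>\<^sub>0) (at 0)"
    by (auto intro!: derivative_eq_intros der)
  \<comment> \<open>The difference is 0 at 0 and nonnegative for arguments below 1, in particular
    within distance 1 of 0, so 0 is a local minimum.\<close>
  then have "\<xi> - 1 * \<xi>\<^sub>0 = 0"
    by (rule DERIV_local_min[of _ _ _ 1]) (auto simp: P0 pressure_lower_bound)
  then show ?thesis by simp
qed

lemma unique_solution_\<xi>\<^sub>0_zero:
  assumes "unique_solution \<xi>\<^sub>0 (t, q)"
  shows "q = 0"
proof (rule ccontr)
  assume q0: "q \<noteq> 0"
  have sol: "(t, q) \<in> D0" "solves_system \<xi>\<^sub>0 (t, q)"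
    and uniq: "\<And>p. p \<in> D0 \<Longrightarrow> solves_system \<xi>\<^sub>0 p \<Longrightarrow> p = (t, q)"
    using assms by (auto simp: unique_solution_def)
  have q1: "q < 1" and "t = 1"
    using solution_constraint[OF sol] by (auto simp: mult_le_0_iff)
  then have Pq: "P 1 q = q * \<xi>\<^sub>0" using sol by (simp add: solves_system_def)
  \<comment> \<open>The chord from 0 to \<open>q\<close>, with \<open>P 1 0 \<le> 0\<close>, bounds
    the pressure from above by the same line that bounds it from below.\<close>
  have lin: "P 1 (s * q) = s * q * \<xi>\<^sub>0" if "0 \<le> s" "s \<le> 1" for s
  proof (rule antisym)
    have "P 1 ((1 - s) * 0 + s * q) \<le> (1 - s) * P 1 0 + s * P 1 q"
      using q1 that by (intro pressure_convex) auto
    also have "\<dots> \<le> (1 - s) * 0 + s * P 1 q"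
      using pressure_1_0_le that by (intro add_right_mono mult_left_mono) auto
    finally show "P 1 (s * q) \<le> s * q * \<xi>\<^sub>0" by (simp add: Pq)
    have "(1 - s) * 0 + s * q < 1" using q1 that by (intro convex_bound_lt) auto
    then show "s * q * \<xi>\<^sub>0 \<le> P 1 (s * q)" using pressure_lower_bound[of "s * q"] by simp
  qed
  have "((\<lambda>x. P 1 x) has_real_derivative \<xi>\<^sub>0) (at (q / 2))"
  proof (rule DERIV_cong_ev[THEN iffD1, OF refl _ refl])
    show "((\<lambda>x. x * \<xi>\<^sub>0) has_real_derivative \<xi>\<^sub>0) (at (q / 2))"
      by (auto intro!: derivative_eq_intros)
    \<comment> \<open>The ball of radius \<open>\<bar>q\<bar> / 2\<close> about the midpoint lies
      between 0 and \<open>q\<close>, where \<open>lin\<close> applies. Writing \<open>x\<close> as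
      \<open>(x / q) * q\<close> covers both signs of \<open>q\<close>.\<close>
    have "\<forall>\<^sub>F x in nhds (q / 2). x \<in> ball (q / 2) (\<bar>q\<bar> / 2)"
      using q0 by (intro eventually_nhds_in_open) auto
    then show "\<forall>\<^sub>F x in nhds (q / 2). x * \<xi>\<^sub>0 = P 1 x"
    proof eventually_elim
      case (elim x)
      then have "0 \<le> x / q" "x / q \<le> 1"
        using q0 by (auto simp: dist_real_def field_simps abs_if split: if_splits)
      with lin[of "x / q"] q0 show ?case by simp
    qed
  qed
  then have "solves_system \<xi>\<^sub>0 (1, q / 2)"
    using lin[of "1 / 2"] by (simp add: solves_system_def)
  moreover have "(1, q / 2) \<in> D0" using q1 by (simp add: D0_def)
  ultimately have "(1, q / 2) = (t, q)" by (intro uniq)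
  with q0 show False by simp
qed

theorem proposition4p14:
  fixes t q :: "real \<Rightarrow> real"
  assumes "\<And>\<xi>. \<xi> > 0 \<Longrightarrow> unique_solution \<xi> (t \<xi>, q \<xi>)"
  shows "(\<forall>\<xi>. 0 < \<xi> \<and> \<xi> < \<xi>\<^sub>0 \<longrightarrow> q \<xi> < 0) \<and> q \<xi>\<^sub>0 = 0 \<and> (\<forall>\<xi>. \<xi> > \<xi>\<^sub>0 \<longrightarrow> q \<xi> > 0)"
proof -
  have sol: "(t \<xi>, q \<xi>) \<in> D0" "solves_system \<xi> (t \<xi>, q \<xi>)" if "0 < \<xi>" for \<xi>
    using assms[OF that] by (auto simp: unique_solution_def)
  \<comment> \<open>Dropping the nonnegative term \<open>(1 - t \<xi>) * ln 2\<close> from the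
    constraint leaves only the comparison of signs.\<close>
  have nonneg: "0 \<le> q \<xi> * (\<xi> - \<xi>\<^sub>0)" if "0 < \<xi>" for \<xi>
  proof -
    have "0 \<le> (1 - t \<xi>) * ln 2" using solution_constraint(3)[OF sol[OF that]] by simp
    with solution_constraint(2)[OF sol[OF that]] show ?thesis
      unfolding right_diff_distrib by linarith
  qed
  have nonzero: "q \<xi> \<noteq> 0" if "0 < \<xi>" "\<xi> \<noteq> \<xi>\<^sub>0" for \<xi>
    using solution_zero_imp_\<xi>\<^sub>0[of "t \<xi>" \<xi>] sol[OF that(1)] that(2) by auto
  have "q \<xi> < 0" if "0 < \<xi>" "\<xi> < \<xi>\<^sub>0" for \<xi>
    using nonneg[of \<xi>] nonzero[of \<xi>] that by (auto simp: zero_le_mult_iff)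
  moreover have "0 < q \<xi>" if "\<xi>\<^sub>0 < \<xi>" for \<xi>
    using nonneg[of \<xi>] nonzero[of \<xi>] that \<xi>\<^sub>0_pos by (auto simp: zero_le_mult_iff)
  moreover have "q \<xi>\<^sub>0 = 0"
    using unique_solution_\<xi>\<^sub>0_zero assms[OF \<xi>\<^sub>0_pos] .
  ultimately show ?thesis by blast
qed

end
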